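(* Let $i\in\{1,\ldots,m-1\}$ with $r_i<\min\{p_i,p_{i+1}\}$, and let the knot vectors $\boldsymbol u,\boldsymbol v$ of $\mathbb{S}_{\boldsymbol r}^{\boldsymbol p}(\Delta)$ be obtained from the knot vectors $\tilde{\boldsymbol u},\tilde{\boldsymbol v}$ of $\mathbb{S}_{\tilde{\boldsymbol r}}^{\boldsymbol p}(\Delta)$ by inserting the single knot $x_i\in(a,b)$ into each, i.e. $\tilde{\boldsymbol r}$ equals $\boldsymbol r$ except that $\tilde r_i=r_i+1$. Let $\{N_k\}_{k=1}^n$ and $\{\tilde N_k\}_{k=1}^{n-1}$ be the GTB-spline bases of $\mathbb{S}_{\boldsymbol r}^{\boldsymbol p}(\Delta)$ and $\mathbb{S}_{\tilde{\boldsymbol r}}^{\boldsymbol p}(\Delta)$, and let $\alpha_k,\beta_{k+1}$ ($k=1,\ldots,n-1$) be the coefficients in $\tilde N_k=\alpha_kN_k+\beta_{k+1}N_{k+1}$. Then every $s\in\mathbb{S}_{\tilde{\boldsymbol r}}^{\boldsymbol p}(\Delta)$ satisfies $$s(x)=\sum_{k=1}^{n-1}\tilde d_k\tilde N_k(x)=\sum_{k=1}^nd_kN_k(x),$$ where $$d_k=\begin{cases}\tilde d_k, & 1\le k\le\mu_v(i),\\ \beta_k\tilde d_{k-1}+\alpha_k\tilde d_k, & \mu_v(i)<k\le\mu_u(i),\\ \tilde d_{k-1}, & \mu_u(i)<k\le n,\end{cases}$$ with $\alpha_k+\beta_k=1$ (for $\mu_v(i)<k\le\mu_u(i)$).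
   Context: Let $\Delta=\{a=:x_0<x_1<\cdots<x_m:=b\}$ be a partition of $[a,b]$, $J_i:=[x_{i-1},x_i)$ for $i=1,\ldots,m-1$ and $J_m:=[x_{m-1},x_m]$. Let $\boldsymbol p=\{p_1,\ldots,p_m\}$ be nonnegative integers and $\boldsymbol r=\{r_0,\ldots,r_m\}$ integers with $r_0=r_m=-1$ and $-1\le r_i\le\min\{p_i,p_{i+1}\}$ for $i=1,\ldots,m-1$. For each $i$, $\mathbb{T}_{p_i}^{(i)}$ is an extended complete Tchebycheff (ECT-) space of dimension $p_i+1$ on $[x_{i-1},x_i]$, i.e. the span of the generalized powers $g_0^{(i)}(x)=w_0^{(i)}(x)$, $g_1^{(i)}(x)=w_0^{(i)}(x)\int_z^x w_1^{(i)}(y_1)\,dy_1$, ..., $g_{p_i}^{(i)}(x)=w_0^{(i)}(x)\int_z^x w_1^{(i)}(y_1)\int_z^{y_1}\cdots\int_z^{y_{p_i-1}}w_{p_i}^{(i)}(y_{p_i})\,dy_{p_i}\cdots dy_1$, with $z\in[x_{i-1},x_i]$ and positive weights $w_j^{(i)}\in C^{p_i-j}([x_{i-1},x_i])$, $j=0,\ldots,p_i$. The spline space $\mathbb{S}_{\boldsymbol r}^{\boldsymbol p}(\Delta)$ consists of all $s:[a,b]\to\mathbb{R}$ with $s|_{J_i}\in\mathbb{T}_{p_i}^{(i)}$ (restricted to $J_i$) for $i=1,\ldots,m$ and $D_-^js(x_i)-D_+^js(x_i)=0$ for $j=0,\ldots,r_i$, $i=1,\ldots,m-1$ ($D_\mp^j$: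 left/right derivatives). Its dimension is $n:=\sum_{i=1}^m(p_i+1)-\sum_{i=1}^{m-1}(r_i+1)$. Knot vectors (nondecreasing, length $n$): in $\boldsymbol u=(u_k)_{k=1}^n$, $x_i$ appears $p_{i+1}-r_i$ times for $i=0,\ldots,m-1$; in $\boldsymbol v=(v_k)_{k=1}^n$, $x_i$ appears $p_i-r_i$ times for $i=1,\ldots,m$. With $u_k=x_i$ and $v_k=x_j$, set $r_u(k):=p_{i+1}-1-\max\{l\ge0:u_k=u_{k+l}\}$ and $r_v(k):=p_j-1-\max\{l\ge0:v_k=v_{k-l}\}$. Set $\mu_u(i):=\sum_{j=0}^{i-1}(p_{j+1}-r_j)$, $\mu_v(i):=\sum_{j=1}^{i}(p_j-r_j)$ (defined from $\boldsymbol r$). A GTB-spline basis of $\mathbb{S}_{\boldsymbol r}^{\boldsymbol p}(\Delta)$ is a basis $\{N_k\}_{k=1}^n$ such that: $N_k>0$ on $(u_k,v_k)$; $N_k=0$ outside $[u_k,v_k]$; $\sum_kN_k=1$ on $[a,b]$; $N_k$ is exactly $C^{r_u(k)}$ at $u_k$ and exactly $C^{r_v(k)}$ at $v_k$; and $\mathrm{span}\{N_k|_{J_i}\}_{k=\mu_u(i)-p_i}^{\mu_u(i)}=\mathbb{T}_{p_i}^{(i)}$ for each $i$. Here "exactly $C^s$ at $x$" means that the jumps at $x$ of the derivatives of order $0,\ldots,s$ vanish and that of order $s+1$ does not, functions being extended by zero outside $[a,b]$. The same definitions, with $\tilde{\boldsymbol r}$ in place of $\boldsymbol r$, apply to $\mathbb{S}_{\tilde{\boldsymbol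 r}}^{\boldsymbol p}(\Delta)$, which is a subspace of $\mathbb{S}_{\boldsymbol r}^{\boldsymbol p}(\Delta)$ of dimension $n-1$. Standing assumption: both spaces admit GTB-spline bases. It is known that each $\tilde N_k$ is then a linear combination of $N_k$ and $N_{k+1}$ only. *)

theory Defs
  imports "HOL-Analysis.Analysis" "HOL-Library.Function_Algebras"
begin

text \<open>Pointwise scalar multiplication makes real-valued functions a real vector space, so that
  the library's \<^const>\<open>span\<close> and \<^const>\<open>independent\<close> apply to spaces of functions.\<close>

instantiation "fun" :: (type, real_vector) real_vector
begin

definition scaleR_fun_def: "c *\<^sub>R f = (\<lambda>x. c *\<^sub>R f x)"

instance
  by standard (auto simp: scaleR_fun_def plus_fun_def scaleR_add_right scaleR_add_left)

end

text \<open>A function on a set \<open>A\<close> of reals is represented by its extension by zero to all reals.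
  Restriction to \<open>A\<close> is then the following linear operation.\<close>

definition restr :: "real set \<Rightarrow> (real \<Rightarrow> real) \<Rightarrow> real \<Rightarrow> real" where
  "restr A f = (\<lambda>y. if y \<in> A then f y else 0)"

text \<open>\<open>f\<close> is of class \<open>C^k\<close> on \<open>S\<close>; at the endpoints of a compact interval \<open>S\<close> the
  derivatives are one-sided.  \<open>F j\<close> is the \<open>j\<close>-th derivative.\<close>

definition Ck_on :: "nat \<Rightarrow> (real \<Rightarrow> real) \<Rightarrow> real set \<Rightarrow> bool" where
  "Ck_on k f S \<longleftrightarrow> (\<exists>F. (\<forall>y\<in>S. F 0 y = f y) \<and>
     (\<forall>j<k. \<forall>y\<in>S. (F j has_real_derivative F (Suc j) y) (at y within S)) \<and>
     continuous_on S (F k))"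

text \<open>\<open>gen_power w z i j\<close> is
  \<open>w_i(y) \<integral>_z^y w_{i+1}(y_1) \<integral>_z^{y_1} ... \<integral>_z^{y_{j-1}} w_{i+j}(y_j) dy_j ... dy_1\<close>
  (oriented integrals), so the generalized power \<open>g_j\<close> is \<open>gen_power w z 0 j\<close>.\<close>

fun gen_power :: "(nat \<Rightarrow> real \<Rightarrow> real) \<Rightarrow> real \<Rightarrow> nat \<Rightarrow> nat \<Rightarrow> real \<Rightarrow> real" where
  "gen_power w z i 0 y = w i y"
| "gen_power w z i (Suc j) y = w i y * (LBINT t=ereal z..ereal y. gen_power w z (Suc i) j t)"

text \<open>\<open>T\<close> is an extended complete Tchebycheff space of dimension \<open>q + 1\<close> on \<open>[c, d]\<close>.\<close>

definition ECT_space :: "nat \<Rightarrow> real \<Rightarrow> real \<Rightarrow> (real \<Rightarrow> real) set \<Rightarrow> bool" where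
  "ECT_space q c d T \<longleftrightarrow> (\<exists>w. \<exists>z\<in>{c..d}.
     (\<forall>j\<le>q. (\<forall>y\<in>{c..d}. 0 < w j y) \<and> Ck_on (q - j) (w j) {c..d}) \<and>
     T = span ((\<lambda>j. restr {c..d} (gen_power w z 0 j)) ` {0..q}))"

definition is_partition :: "nat \<Rightarrow> (nat \<Rightarrow> real) \<Rightarrow> bool" where
  "is_partition m x \<longleftrightarrow> 1 \<le> m \<and> (\<forall>i<m. x i < x (Suc i))"

definition smoothness_vector :: "nat \<Rightarrow> (nat \<Rightarrow> nat) \<Rightarrow> (nat \<Rightarrow> int) \<Rightarrow> bool" where
  "smoothness_vector m p r \<longleftrightarrow> r 0 = -1 \<and> r m = -1 \<and>
     (\<forall>i\<in>{1..m-1}. -1 \<le> r i \<and> r i \<le> min (int (p i)) (int (p (i + 1))))"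

definition J :: "nat \<Rightarrow> (nat \<Rightarrow> real) \<Rightarrow> nat \<Rightarrow> real set" where
  "J m x i = (if i = m then {x (i - 1)..x i} else {x (i - 1)..<x i})"

text \<open>One-sided derivatives \<open>D_-^j f(y)\<close> and \<open>D_+^j f(y)\<close>, taken as one-sided limits of the
  \<open>j\<close>-th derivative: a spline belongs at a breakpoint to the piece on the right, so its value
  there must not enter the left derivatives (in particular, \<open>D_-^0 f(y)\<close> is the left limit).\<close>

definition left_deriv :: "nat \<Rightarrow> (real \<Rightarrow> real) \<Rightarrow> real \<Rightarrow> real" where
  "left_deriv j f y = Lim (at_left y) ((deriv ^^ j) f)"

definition right_deriv :: "nat \<Rightarrow> (real \<Rightarrow> real) \<Rightarrow> real \<Rightarrow> real" where
  "right_deriv j f y = Lim (at_right y) ((deriv ^^ j) f)"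

definition jump :: "nat \<Rightarrow> (real \<Rightarrow> real) \<Rightarrow> real \<Rightarrow> real" where
  "jump j f y = left_deriv j f y - right_deriv j f y"

definition exactly_C :: "int \<Rightarrow> (real \<Rightarrow> real) \<Rightarrow> real \<Rightarrow> bool" where
  "exactly_C s f y \<longleftrightarrow> (\<forall>j::nat. int j \<le> s \<longrightarrow> jump j f y = 0) \<and> jump (nat (s + 1)) f y \<noteq> 0"

definition spline_space ::
  "nat \<Rightarrow> (nat \<Rightarrow> real) \<Rightarrow> (nat \<Rightarrow> nat) \<Rightarrow> (nat \<Rightarrow> int) \<Rightarrow> (nat \<Rightarrow> (real \<Rightarrow> real) set) \<Rightarrow> (real \<Rightarrow> real) set"
where
  "spline_space m x p r T = {s.
     (\<forall>y. y \<notin> {x 0..x m} \<longrightarrow> s y = 0) \<and>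
     (\<forall>i\<in>{1..m}. restr (J m x i) s \<in> restr (J m x i) ` T i) \<and>
     (\<forall>i\<in>{1..m-1}. \<forall>j::nat. int j \<le> r i \<longrightarrow> jump j s (x i) = 0)}"

definition spline_dim :: "nat \<Rightarrow> (nat \<Rightarrow> nat) \<Rightarrow> (nat \<Rightarrow> int) \<Rightarrow> nat" where
  "spline_dim m p r = nat ((\<Sum>i=1..m. int (p i) + 1) - (\<Sum>i=1..m-1. r i + 1))"

text \<open>The knot vectors, first as lists of indices of breakpoints.  The knots are numbered from 1,
  hence the shift in the list access.\<close>

definition u_indices :: "nat \<Rightarrow> (nat \<Rightarrow> nat) \<Rightarrow> (nat \<Rightarrow> int) \<Rightarrow> nat list" where
  "u_indices m p r = concat (map (\<lambda>i. replicate (nat (int (p (i + 1)) - r i)) i) [0..<m])"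

definition v_indices :: "nat \<Rightarrow> (nat \<Rightarrow> nat) \<Rightarrow> (nat \<Rightarrow> int) \<Rightarrow> nat list" where
  "v_indices m p r = concat (map (\<lambda>i. replicate (nat (int (p i) - r i)) i) [1..<m+1])"

definition u_knot :: "nat \<Rightarrow> (nat \<Rightarrow> real) \<Rightarrow> (nat \<Rightarrow> nat) \<Rightarrow> (nat \<Rightarrow> int) \<Rightarrow> nat \<Rightarrow> real" where
  "u_knot m x p r k = x (u_indices m p r ! (k - 1))"

definition v_knot :: "nat \<Rightarrow> (nat \<Rightarrow> real) \<Rightarrow> (nat \<Rightarrow> nat) \<Rightarrow> (nat \<Rightarrow> int) \<Rightarrow> nat \<Rightarrow> real" where
  "v_knot m x p r k = x (v_indices m p r ! (k - 1))"

definition r_u :: "nat \<Rightarrow> (nat \<Rightarrow> real) \<Rightarrow> (nat \<Rightarrow> nat) \<Rightarrow> (nat \<Rightarrow> int) \<Rightarrow> nat \<Rightarrow> int" where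
  "r_u m x p r k = int (p (u_indices m p r ! (k - 1) + 1)) - 1 -
     int (Max {l. k + l \<le> spline_dim m p r \<and> u_knot m x p r k = u_knot m x p r (k + l)})"

definition r_v :: "nat \<Rightarrow> (nat \<Rightarrow> real) \<Rightarrow> (nat \<Rightarrow> nat) \<Rightarrow> (nat \<Rightarrow> int) \<Rightarrow> nat \<Rightarrow> int" where
  "r_v m x p r k = int (p (v_indices m p r ! (k - 1))) - 1 -
     int (Max {l. l < k \<and> v_knot m x p r k = v_knot m x p r (k - l)})"

text \<open>All summands below are nonnegative for a \<^const>\<open>smoothness_vector\<close>, so the conversion to
  natural numbers loses nothing.\<close>

definition mu_u :: "(nat \<Rightarrow> nat) \<Rightarrow> (nat \<Rightarrow> int) \<Rightarrow> nat \<Rightarrow> nat" where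
  "mu_u p r i = nat (\<Sum>j<i. int (p (j + 1)) - r j)"

definition mu_v :: "(nat \<Rightarrow> nat) \<Rightarrow> (nat \<Rightarrow> int) \<Rightarrow> nat \<Rightarrow> nat" where
  "mu_v p r i = nat (\<Sum>j=1..i. int (p j) - r j)"

definition GTB_basis ::
  "nat \<Rightarrow> (nat \<Rightarrow> real) \<Rightarrow> (nat \<Rightarrow> nat) \<Rightarrow> (nat \<Rightarrow> int) \<Rightarrow> (nat \<Rightarrow> (real \<Rightarrow> real) set)
    \<Rightarrow> (nat \<Rightarrow> real \<Rightarrow> real) \<Rightarrow> bool"
where
  "GTB_basis m x p r T N \<longleftrightarrow>
     inj_on N {1..spline_dim m p r} \<and>
     independent (N ` {1..spline_dim m p r}) \<and>
     span (N ` {1..spline_dim m p r}) = spline_space m x p r T \<and>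
     (\<forall>k\<in>{1..spline_dim m p r}.
        (\<forall>y\<in>{u_knot m x p r k<..<v_knot m x p r k}. 0 < N k y) \<and>
        (\<forall>y. y \<notin> {u_knot m x p r k..v_knot m x p r k} \<longrightarrow> N k y = 0) \<and>
        exactly_C (r_u m x p r k) (N k) (u_knot m x p r k) \<and>
        exactly_C (r_v m x p r k) (N k) (v_knot m x p r k)) \<and>
     (\<forall>y\<in>{x 0..x m}. (\<Sum>k=1..spline_dim m p r. N k y) = 1) \<and>
     (\<forall>i\<in>{1..m}. span ((\<lambda>k. restr (J m x i) (N k)) ` {mu_u p r i - p i..mu_u p r i}) =
        restr (J m x i) ` T i)"

end

theory Submission
  imports Defs
begin

text \<open>Substituting the two-term relation \<open>Nt k = \<alpha> k N k + \<beta> (k + 1) N (k + 1)\<close> into an expansion with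
  coefficients \<open>dt\<close> gives \<open>N k\<close> the coefficient \<open>\<alpha> k dt k + \<beta> k dt (k - 1)\<close>, where \<open>\<alpha> n\<close> and \<open>\<beta> 1\<close> count as
  zero (\<open>refined_expansion\<close>).  Both bases are partitions of unity, so linear independence of the \<open>N k\<close>
  forces \<open>\<alpha> k + \<beta> k = 1\<close> for every \<open>k\<close> (\<open>weights_sum\<close>).  The three cases for the new coefficients then
  amount to \<open>\<beta> k = 0\<close> up to \<open>mu_v p r i\<close> (\<open>beta_zero\<close>) and \<open>\<alpha> k = 0\<close> beyond \<open>mu_u p r i\<close>
  (\<open>alpha_zero\<close>).

  For \<open>\<beta> k\<close> only right ends of supports matter.  The knots of \<open>v\<close> numbered below \<open>mu_v p r i\<close> are the same
  in both spaces, so \<open>Nt (k - 1)\<close> and \<open>N (k - 1)\<close> end at the same knot and are equally smooth there.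
  But \<open>N k\<close> ends at a later knot, or at the same one with exactly one order of smoothness less.  In the first case the relation is evaluated at a point that only the support of
  \<open>N k\<close> reaches; in the second case the jumps of order \<open>r_v k + 1\<close> are compared.  Either way \<open>\<beta> k\<close> is
  multiplied by something nonzero and must vanish.  The argument for \<open>\<alpha> k\<close> is the mirror image, with left
  ends of supports and the knots of \<open>u\<close>.

  Comparing jumps needs one-sided derivatives that exist and depend linearly on the function.  The \<open>j\<close>-th
  Tchebycheff space consists of functions of class \<open>C^(p j)\<close> up to the end points of its interval
  (\<open>ECT_space_Ck\<close>), and the orders that occur do not exceed the degree of
  the piece inside the support.  Beyond the end of its support a spline vanishes, so only one side contributes to a jump there.

  The combinatorial part consists of closed forms for positions and smoothness orders: the copies of \<open>x j\<close>
  occupy the places between consecutive values of \<open>mu_v\<close> or \<open>mu_u\<close> (\<open>v_index_iff\<close>, \<open>u_index_iff\<close>),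
  whence \<open>r_v\<close> and \<open>r_u\<close> (\<open>r_v_eq\<close>, \<open>r_u_eq\<close>).\<close>

section \<open>Functions of class \<open>C^k\<close>\<close>

lemma Ck_on_0: "Ck_on 0 f S \<longleftrightarrow> continuous_on S f"
proof
  assume "Ck_on 0 f S"
  then obtain F where "\<forall>y\<in>S. F 0 y = f y" "continuous_on S (F (0::nat))"
    unfolding Ck_on_def by blast
  then show "continuous_on S f" using continuous_on_eq[of S "F 0" f] by simp
next
  assume "continuous_on S f"
  then have "(\<forall>y\<in>S. f y = f y) \<and> (\<forall>j::nat<0. \<forall>y\<in>S. (f has_real_derivative f y) (at y within S)) \<and>
     continuous_on S f" by simp
  then show "Ck_on 0 f S"
    unfolding Ck_on_def by (rule exI[of _ "\<lambda>_. f"])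
qed

lemma Ck_onI:
  assumes "\<And>y. y \<in> S \<Longrightarrow> F 0 y = f y"
    "\<And>j y. j < k \<Longrightarrow> y \<in> S \<Longrightarrow> (F j has_real_derivative F (Suc j) y) (at y within S)"
    "continuous_on S (F k)"
  shows "Ck_on k f S"
  unfolding Ck_on_def using assms by (intro exI[of _ F]) simp

text \<open>This lemma and its converse make inductions on the order possible; the definition provides all
derivatives at once.\<close>

lemma Ck_on_SucE:
  assumes "Ck_on (Suc k) f S"
  obtains f' where "\<And>y. y \<in> S \<Longrightarrow> (f has_real_derivative f' y) (at y within S)" "Ck_on k f' S"
proof -
  obtain F where "(\<forall>y\<in>S. F 0 y = f y) \<and>
     (\<forall>j<Suc k. \<forall>y\<in>S. (F j has_real_derivative F (Suc j) y) (at y within S)) \<and>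
     continuous_on S (F (Suc k))"
    using assms unfolding Ck_on_def ..
  then have F: "\<And>y. y \<in> S \<Longrightarrow> F 0 y = f y"
    "\<And>j y. j < Suc k \<Longrightarrow> y \<in> S \<Longrightarrow> (F j has_real_derivative F (Suc j) y) (at y within S)"
    "continuous_on S (F (Suc k))"
    by simp_all
  have "(f has_real_derivative F 1 y) (at y within S)" if "y \<in> S" for y
  proof (rule has_field_derivative_transform_within[of "F 0" _ y S 1])
    show "(F 0 has_real_derivative F 1 y) (at y within S)" using F(2)[of 0 y] that by simp
  qed (use F(1) that in simp_all)
  moreover have "Ck_on k (F 1) S"
  proof (rule Ck_onI[of S "\<lambda>j. F (Suc j)"])
    show "(F (Suc j) has_real_derivative F (Suc (Suc j)) y) (at y within S)"
      if "j < k" "y \<in> S" for j y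
      using F(2)[of "Suc j" y] that by simp
  qed (use F(3) in simp_all)
  ultimately show thesis by (rule that)
qed

lemma Ck_on_SucI:
  assumes f': "\<And>y. y \<in> S \<Longrightarrow> (f has_real_derivative f' y) (at y within S)" and "Ck_on k f' S"
  shows "Ck_on (Suc k) f S"
proof -
  obtain F where "(\<forall>y\<in>S. F 0 y = f' y) \<and>
     (\<forall>j<k. \<forall>y\<in>S. (F j has_real_derivative F (Suc j) y) (at y within S)) \<and>
     continuous_on S (F (k))"
    using assms(2) unfolding Ck_on_def ..
  then have F: "\<And>y. y \<in> S \<Longrightarrow> F 0 y = f' y"
    "\<And>j y. j < k \<Longrightarrow> y \<in> S \<Longrightarrow> (F j has_real_derivative F (Suc j) y) (at y within S)"
    "continuous_on S (F (k))"
    by simp_all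
  let ?G = "\<lambda>j. case j of 0 \<Rightarrow> f | Suc j \<Rightarrow> F j"
  show ?thesis
  proof (rule Ck_onI[of S ?G])
    show "(?G j has_real_derivative ?G (Suc j) y) (at y within S)" if "j < Suc k" "y \<in> S" for j y
    proof (cases j)
      case 0
      then show ?thesis using f'[OF \<open>y \<in> S\<close>] F(1)[OF \<open>y \<in> S\<close>] by simp
    next
      case (Suc l)
      then show ?thesis using F(2)[of l y] that by simp
    qed
  qed (use F(3) in simp_all)
qed

lemma Ck_on_cong:
  assumes "\<And>y. y \<in> S \<Longrightarrow> f y = g y"
  shows "Ck_on k f S \<longleftrightarrow> Ck_on k g S"
  using assms by (simp add: Ck_on_def)

lemma Ck_on_lower: "Ck_on (Suc k) f S \<Longrightarrow> Ck_on k f S"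
proof (induction k arbitrary: f)
  case 0
  then obtain f' where "\<And>y. y \<in> S \<Longrightarrow> (f has_real_derivative f' y) (at y within S)"
    by (rule Ck_on_SucE) (rule that)
  then show ?case unfolding Ck_on_0 by (rule DERIV_continuous_on)
next
  case (Suc k)
  obtain f' where "\<And>y. y \<in> S \<Longrightarrow> (f has_real_derivative f' y) (at y within S)"
    "Ck_on (Suc k) f' S"
    using Suc.prems by (rule Ck_on_SucE) (rule that)
  then show ?case by (intro Ck_on_SucI[of S f f'] Suc.IH)
qed

lemma Ck_on_const: "Ck_on k (\<lambda>_. c) S"
proof (induction k arbitrary: c)
  case 0
  then show ?case by (simp add: Ck_on_0)
next
  case (Suc k)
  show ?case by (rule Ck_on_SucI[OF DERIV_const Suc])
qed

lemma Ck_on_add: "Ck_on k f S \<Longrightarrow> Ck_on k g S \<Longrightarrow> Ck_on k (\<lambda>y. f y + g y) S"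
proof (induction k arbitrary: f g)
  case 0
  then show ?case by (simp add: Ck_on_0 continuous_on_add)
next
  case (Suc k)
  obtain f' where f': "\<And>y. y \<in> S \<Longrightarrow> (f has_real_derivative f' y) (at y within S)" "Ck_on k f' S"
    using Suc.prems(1) by (rule Ck_on_SucE) (rule that)
  obtain g' where g': "\<And>y. y \<in> S \<Longrightarrow> (g has_real_derivative g' y) (at y within S)" "Ck_on k g' S"
    using Suc.prems(2) by (rule Ck_on_SucE) (rule that)
  show ?case
  proof (rule Ck_on_SucI[of _ _ "\<lambda>y. f' y + g' y"])
    show "((\<lambda>y. f y + g y) has_real_derivative f' y + g' y) (at y within S)" if "y \<in> S" for y
      by (rule DERIV_add[OF f'(1)[OF that] g'(1)[OF that]])
    show "Ck_on k (\<lambda>y. f' y + g' y) S"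
      by (rule Suc.IH[OF f'(2) g'(2)])
  qed
qed

lemma Ck_on_mult: "Ck_on k f S \<Longrightarrow> Ck_on k g S \<Longrightarrow> Ck_on k (\<lambda>y. f y * g y) S"
proof (induction k arbitrary: f g)
  case 0
  then show ?case by (simp add: Ck_on_0 continuous_on_mult)
next
  case (Suc k)
  obtain f' where f': "\<And>y. y \<in> S \<Longrightarrow> (f has_real_derivative f' y) (at y within S)" "Ck_on k f' S"
    using Suc.prems(1) by (rule Ck_on_SucE) (rule that)
  obtain g' where g': "\<And>y. y \<in> S \<Longrightarrow> (g has_real_derivative g' y) (at y within S)" "Ck_on k g' S"
    using Suc.prems(2) by (rule Ck_on_SucE) (rule that)
  show ?case
  proof (rule Ck_on_SucI[of _ _ "\<lambda>y. f y * g' y + f' y * g y"])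
    show "((\<lambda>y. f y * g y) has_real_derivative f y * g' y + f' y * g y) (at y within S)"
      if "y \<in> S" for y
      by (rule DERIV_mult'[OF f'(1)[OF that] g'(1)[OF that]])
    have "Ck_on k (\<lambda>y. f y * g' y) S" "Ck_on k (\<lambda>y. f' y * g y) S"
      using Suc.IH f'(2) g'(2) Suc.prems[THEN Ck_on_lower] by simp_all
    then show "Ck_on k (\<lambda>y. f y * g' y + f' y * g y) S" by (rule Ck_on_add)
  qed
qed

lemma Ck_on_integral:
  assumes "Ck_on k f {c..d}" "z \<in> {c..d}"
  shows "Ck_on (Suc k) (\<lambda>y. LBINT t=ereal z..ereal y. f t) {c..d}"
proof -
  have "Ck_on 0 f {c..d}" using assms(1)
  proof (induction k)
    case (Suc k)
    then show ?case using Ck_on_lower[of k f] by simp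
  qed
  then have "continuous_on {c..d} f" by (simp add: Ck_on_0)
  then have "((\<lambda>y. LBINT t=ereal z..ereal y. f t) has_real_derivative f y) (at y within {c..d})"
    if "y \<in> {c..d}" for y
    using assms(2) that
    by (simp add: has_real_derivative_iff_has_vector_derivative interval_integral_FTC2)
  then show ?thesis using assms(1) by (rule Ck_on_SucI)
qed

section \<open>Smoothness of Tchebycheff spaces\<close>

text \<open>Each nested integration gains the derivative that passing from \<^term>\<open>w (Suc i)\<close> to \<^term>\<open>w i\<close> allows: the
integral of a \<open>C^(q-i-1)\<close> function is \<open>C^(q-i)\<close>, just as smooth as the weight in front of it.\<close>

lemma Ck_on_gen_power:
  assumes "\<And>l. l \<le> q \<Longrightarrow> Ck_on (q - l) (w l) {c..d}" "z \<in> {c..d}" "i + j \<le> q"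
  shows "Ck_on (q - i) (gen_power w z i j) {c..d}"
  using assms(3)
proof (induction j arbitrary: i)
  case 0
  have "gen_power w z i 0 = w i" by (simp add: fun_eq_iff)
  then show ?case using assms(1)[of i] 0 by simp
next
  case (Suc j)
  have "Ck_on (Suc (q - Suc i)) (\<lambda>y. LBINT t=ereal z..ereal y. gen_power w z (Suc i) j t) {c..d}"
    using Suc assms(2) by (intro Ck_on_integral) auto
  then have "Ck_on (q - i) (\<lambda>y. w i y * (LBINT t=ereal z..ereal y. gen_power w z (Suc i) j t)) {c..d}"
    using Suc.prems assms(1)[of i] by (intro Ck_on_mult) (auto simp: Suc_diff_Suc)
  moreover have "gen_power w z i (Suc j) = (\<lambda>y. w i y * (LBINT t=ereal z..ereal y. gen_power w z (Suc i) j t))"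
    by (simp add: fun_eq_iff)
  ultimately show ?case by simp
qed

lemma ECT_space_Ck:
  assumes "ECT_space q c d T" "t \<in> T"
  shows "Ck_on q t {c..d}"
proof -
  obtain w where "\<exists>z\<in>{c..d}.
     (\<forall>j\<le>q. (\<forall>y\<in>{c..d}. 0 < w j y) \<and> Ck_on (q - j) (w j) {c..d}) \<and>
     T = span ((\<lambda>j. restr {c..d} (gen_power w z 0 j)) ` {0..q})"
    using assms(1) unfolding ECT_space_def ..
  then obtain z where z: "z \<in> {c..d}" and
    wT: "(\<forall>j\<le>q. (\<forall>y\<in>{c..d}. 0 < w j y) \<and> Ck_on (q - j) (w j) {c..d}) \<and>
     T = span ((\<lambda>j. restr {c..d} (gen_power w z 0 j)) ` {0..q})" ..
  then have w: "\<And>l. l \<le> q \<Longrightarrow> Ck_on (q - l) (w l) {c..d}"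
    and T: "T = span ((\<lambda>j. restr {c..d} (gen_power w z 0 j)) ` {0..q})"
    by simp_all
  have "t \<in> span ((\<lambda>j. restr {c..d} (gen_power w z 0 j)) ` {0..q})"
    using assms(2) T by simp
  then show ?thesis
  proof (induction rule: span_induct_alt)
    case base
    then show ?case using Ck_on_const[of q 0] by (simp add: zero_fun_def)
  next
    case (step a v t)
    then obtain j where j: "j \<le> q" "v = restr {c..d} (gen_power w z 0 j)" by auto
    have "Ck_on q (gen_power w z 0 j) {c..d}"
      using Ck_on_gen_power[of q w c d z 0 j] w z j by simp
    then have "Ck_on q v {c..d}"
      by (subst Ck_on_cong[of _ _ "gen_power w z 0 j"]) (simp_all add: restr_def j)
    then have "Ck_on q (\<lambda>y. a * v y + t y) {c..d}"
      using step by (intro Ck_on_add Ck_on_mult Ck_on_const)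
    then show ?case by (simp add: scaleR_fun_def plus_fun_def)
  qed
qed

section \<open>One-sided derivatives and jumps\<close>

lemma iterated_deriv_Ck:
  assumes F: "\<And>j y. j < q \<Longrightarrow> y \<in> {c..d} \<Longrightarrow>
      (F j has_real_derivative F (Suc j) y) (at y within {c..d})"
    and f: "\<And>y. y \<in> {c<..<d} \<Longrightarrow> f y = F 0 y"
    and "j \<le> q" "y \<in> {c<..<d}"
  shows "(deriv ^^ j) f y = F j y"
  using assms(3,4)
proof (induction j arbitrary: y)
  case 0
  then show ?case using f by simp
next
  case (Suc j)
  have "(F j has_real_derivative F (Suc j) y) (at y within {c..d})"
    using Suc.prems F by simp
  then have "(F j has_real_derivative F (Suc j) y) (at y)"
    using Suc.prems by (simp add: at_within_Icc_at)
  then have "((deriv ^^ j) f has_real_derivative F (Suc j) y) (at y)"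
    by (rule has_field_derivative_transform_within_open[of _ _ _ "{c<..<d}"])
      (use Suc in auto)
  then show ?case by (simp add: DERIV_imp_deriv)
qed

text \<open>The iterated derivative \<^term>\<open>(deriv ^^ j) f\<close> is two-sided, so it is known to agree with the data
\<^term>\<open>F j\<close> only on the open interval.  That is enough: one-sided limits at an end point see nothing
else, and \<^term>\<open>F j\<close> is continuous up to the end points.\<close>

lemma tendsto_iterated_deriv:
  assumes "c < d"
    and F: "\<And>j y. j < q \<Longrightarrow> y \<in> {c..d} \<Longrightarrow>
      (F j has_real_derivative F (Suc j) y) (at y within {c..d})"
    and cont: "continuous_on {c..d} (F q)"
    and f: "\<And>y. y \<in> {c<..<d} \<Longrightarrow> f y = F 0 y"
    and "j \<le> q"
  shows "((deriv ^^ j) f \<longlongrightarrow> F j d) (at_left d)" and "((deriv ^^ j) f \<longlongrightarrow> F j c) (at_right c)"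
proof -
  have cont: "continuous_on {c..d} (F j)"
  proof (cases "j = q")
    case False
    then have "(F j has_real_derivative F (Suc j) y) (at y within {c..d})" if "y \<in> {c..d}" for y
      using F[of j y] \<open>j \<le> q\<close> that by simp
    then show ?thesis by (rule DERIV_continuous_on)
  qed (use cont in simp)
  have "(F j \<longlongrightarrow> F j d) (at d within {c..d})" "(F j \<longlongrightarrow> F j c) (at c within {c..d})"
    using cont \<open>c < d\<close> unfolding continuous_on_def by auto
  then have lim: "(F j \<longlongrightarrow> F j d) (at_left d)" "(F j \<longlongrightarrow> F j c) (at_right c)"
    using \<open>c < d\<close> by (simp_all add: at_within_Icc_at_left at_within_Icc_at_right)
  have eq: "F j y = (deriv ^^ j) f y" if "y \<in> {c<..<d}" for y
    using iterated_deriv_Ck[OF F f \<open>j \<le> q\<close> that] by simp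
  have ev: "\<forall>\<^sub>F y in at_left d. F j y = (deriv ^^ j) f y"
       "\<forall>\<^sub>F y in at_right c. F j y = (deriv ^^ j) f y"
    using eventually_at_left_real[OF \<open>c < d\<close>] eventually_at_right_real[OF \<open>c < d\<close>] eq
    by (auto elim!: eventually_mono)
  show "((deriv ^^ j) f \<longlongrightarrow> F j d) (at_left d)" "((deriv ^^ j) f \<longlongrightarrow> F j c) (at_right c)"
    using lim ev by (auto elim: Lim_transform_eventually)
qed

lemma one_sided_deriv_eq:
  assumes "c < d"
    and "\<And>j y. j < q \<Longrightarrow> y \<in> {c..d} \<Longrightarrow>
      (F j has_real_derivative F (Suc j) y) (at y within {c..d})"
    and "continuous_on {c..d} (F q)"
    and "\<And>y. y \<in> {c<..<d} \<Longrightarrow> f y = F 0 y"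
    and "j \<le> q"
  shows "left_deriv j f d = F j d" and "right_deriv j f c = F j c"
  using tendsto_iterated_deriv[OF assms] unfolding left_deriv_def right_deriv_def
  by (auto intro!: tendsto_Lim)

text \<open>\<^const>\<open>Lim\<close> is linear only where the limits exist.  Here they do, because \<open>g\<close> and \<open>h\<close> agree on the open
interval with functions that are \<open>C^q\<close> up to the end points.  This form fits splines,
whose value at a breakpoint may belong to the next piece.\<close>

lemma one_sided_deriv_linear:
  assumes "c < d" "Ck_on q g0 {c..d}" "Ck_on q h0 {c..d}" "j \<le> q"
    and g: "\<And>y. y \<in> {c<..<d} \<Longrightarrow> g y = g0 y"
    and h: "\<And>y. y \<in> {c<..<d} \<Longrightarrow> h y = h0 y"
    and f: "\<And>y. y \<in> {c<..<d} \<Longrightarrow> f y = \<alpha> * g y + \<beta> * h y"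
  shows "left_deriv j f d = \<alpha> * left_deriv j g d + \<beta> * left_deriv j h d"
    and "right_deriv j f c = \<alpha> * right_deriv j g c + \<beta> * right_deriv j h c"
proof -
  obtain G where "(\<forall>y\<in>{c..d}. G 0 y = g0 y) \<and>
     (\<forall>j<q. \<forall>y\<in>{c..d}. (G j has_real_derivative G (Suc j) y) (at y within {c..d})) \<and>
     continuous_on {c..d} (G (q))"
    using assms(2) unfolding Ck_on_def ..
  then have G: "\<And>y. y \<in> {c..d} \<Longrightarrow> G 0 y = g0 y"
    "\<And>j y. j < q \<Longrightarrow> y \<in> {c..d} \<Longrightarrow> (G j has_real_derivative G (Suc j) y) (at y within {c..d})"
    "continuous_on {c..d} (G (q))"
    by simp_all
  obtain H where "(\<forall>y\<in>{c..d}. H 0 y = h0 y) \<and>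
     (\<forall>j<q. \<forall>y\<in>{c..d}. (H j has_real_derivative H (Suc j) y) (at y within {c..d})) \<and>
     continuous_on {c..d} (H (q))"
    using assms(3) unfolding Ck_on_def ..
  then have H: "\<And>y. y \<in> {c..d} \<Longrightarrow> H 0 y = h0 y"
    "\<And>j y. j < q \<Longrightarrow> y \<in> {c..d} \<Longrightarrow> (H j has_real_derivative H (Suc j) y) (at y within {c..d})"
    "continuous_on {c..d} (H (q))"
    by simp_all
  note g_derivs = one_sided_deriv_eq[where f = g, OF \<open>c < d\<close> G(2,3) _ \<open>j \<le> q\<close>]
  note h_derivs = one_sided_deriv_eq[where f = h, OF \<open>c < d\<close> H(2,3) _ \<open>j \<le> q\<close>]
  let ?F = "\<lambda>j y. \<alpha> * G j y + \<beta> * H j y"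
  have der: "(?F j has_real_derivative ?F (Suc j) y) (at y within {c..d})"
    if "j < q" "y \<in> {c..d}" for j y
    using that by (intro DERIV_add DERIV_cmult G(2) H(2))
  have cont: "continuous_on {c..d} (?F q)"
    using G(3) H(3) by (intro continuous_intros)
  have eq: "f y = ?F 0 y" if "y \<in> {c<..<d}" for y
    using that f g h G(1) H(1) by simp
  note f_derivs = one_sided_deriv_eq[where f = f and F = ?F, OF \<open>c < d\<close> der cont eq \<open>j \<le> q\<close>]
  show "left_deriv j f d = \<alpha> * left_deriv j g d + \<beta> * left_deriv j h d"
    using f_derivs(1) g_derivs(1) h_derivs(1) g h G(1) H(1) by simp
  show "right_deriv j f c = \<alpha> * right_deriv j g c + \<beta> * right_deriv j h c"
    using f_derivs(2) g_derivs(2) h_derivs(2) g h G(1) H(1) by simp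
qed

lemma one_sided_deriv_vanishing:
  assumes "c < d" "\<And>y. y \<in> {c<..<d} \<Longrightarrow> f y = 0"
  shows "left_deriv j f d = 0" and "right_deriv j f c = 0"
  using one_sided_deriv_eq[where F = "\<lambda>_ _. 0" and q = j and c = c and d = d and f = f and j = j] assms
  by auto

text \<open>At an end of the support one side contributes nothing, so a jump is a single one-sided derivative.  Thus
the derivatives of one piece suffice, even if their order is too high for the piece on the other side.\<close>

lemma jump_right_end:
  assumes "\<And>y. y > v \<Longrightarrow> f y = 0"
  shows "jump j f v = left_deriv j f v"
  using one_sided_deriv_vanishing(2)[of v "v + 1" f j] assms by (simp add: jump_def)

lemma jump_left_end:
  assumes "\<And>y. y < u \<Longrightarrow> f y = 0"
  shows "jump j f u = - right_deriv j f u"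
  using one_sided_deriv_vanishing(1)[of "u - 1" u f j] assms by (simp add: jump_def)

section \<open>Knot vectors\<close>

definition index_runs :: "(nat \<Rightarrow> nat) \<Rightarrow> nat \<Rightarrow> nat \<Rightarrow> nat list" where
  "index_runs c lo hi = concat (map (\<lambda>j. replicate (c j) j) [lo..<hi])"

lemma index_runs_Suc:
  "lo \<le> hi \<Longrightarrow> index_runs c lo (Suc hi) = index_runs c lo hi @ replicate (c hi) hi"
  by (simp add: index_runs_def)

lemma length_index_runs: "lo \<le> hi \<Longrightarrow> length (index_runs c lo hi) = sum c {lo..<hi}"
proof (induction hi rule: dec_induct)
  case base
  then show ?case by (simp add: index_runs_def)
qed (simp add: index_runs_Suc)

text \<open>All information on knot vectors is drawn from this equivalence; being an equivalence, it identifies an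
entry as well as locating it.\<close>

lemma nth_index_runs_iff:
  assumes "lo \<le> hi" "k < sum c {lo..<hi}"
  shows "index_runs c lo hi ! k = j \<longleftrightarrow>
    lo \<le> j \<and> j < hi \<and> sum c {lo..<j} \<le> k \<and> k < sum c {lo..<Suc j}"
  using assms
proof (induction hi rule: dec_induct)
  case base
  then show ?case by simp
next
  case (step hi)
  show ?case
  proof (cases "k < sum c {lo..<hi}")
    case True
    then show ?thesis
      using step by (auto simp: index_runs_Suc nth_append length_index_runs less_Suc_eq)
  next
    case False
    then have "index_runs c lo (Suc hi) ! k = hi"
      using step by (auto simp: index_runs_Suc nth_append length_index_runs)
    moreover have "sum c {lo..<Suc j} \<le> sum c {lo..<hi}" if "j < hi"
      using that by (intro sum_mono2) auto
    ultimately show ?thesis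
      using False step by (auto simp: less_Suc_eq)
  qed
qed

lemma int_mu_v:
  assumes "smoothness_vector m p r" "i \<le> m"
  shows "int (mu_v p r i) = (\<Sum>j=1..i. int (p j) - r j)"
    and "mu_v p r i = (\<Sum>j=1..<Suc i. nat (int (p j) - r j))"
proof -
  have nn: "0 \<le> int (p j) - r j" if "j \<in> {1..i}" for j
    using that assms unfolding smoothness_vector_def by (cases "j = m") force+
  then have "0 \<le> (\<Sum>j=1..i. int (p j) - r j)" by (rule sum_nonneg)
  then show *: "int (mu_v p r i) = (\<Sum>j=1..i. int (p j) - r j)"
    by (simp add: mu_v_def)
  have "(\<Sum>j=1..i. int (p j) - r j) = int (\<Sum>j=1..<Suc i. nat (int (p j) - r j))"
    using nn unfolding of_nat_sum by (intro sum.cong) auto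
  then show "mu_v p r i = (\<Sum>j=1..<Suc i. nat (int (p j) - r j))"
    using * by linarith
qed

lemma int_mu_u:
  assumes "smoothness_vector m p r" "i \<le> m"
  shows "int (mu_u p r i) = (\<Sum>j<i. int (p (j + 1)) - r j)"
    and "mu_u p r i = (\<Sum>j=0..<i. nat (int (p (j + 1)) - r j))"
proof -
  have nn: "0 \<le> int (p (j + 1)) - r j" if "j \<in> {..<i}" for j
    using that assms unfolding smoothness_vector_def by (cases "j = 0") force+
  then have "0 \<le> (\<Sum>j<i. int (p (j + 1)) - r j)" by (rule sum_nonneg)
  then show *: "int (mu_u p r i) = (\<Sum>j<i. int (p (j + 1)) - r j)"
    by (simp add: mu_u_def)
  have "(\<Sum>j<i. int (p (j + 1)) - r j) = int (\<Sum>j=0..<i. nat (int (p (j + 1)) - r j))"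
    using nn unfolding of_nat_sum by (intro sum.cong) auto
  then show "mu_u p r i = (\<Sum>j=0..<i. nat (int (p (j + 1)) - r j))"
    using * by linarith
qed

lemma mu_v_mono:
  assumes "smoothness_vector m p r" "i \<le> j" "j \<le> m"
  shows "mu_v p r i \<le> mu_v p r j"
  using assms by (simp add: int_mu_v(2)[OF assms(1)] sum_mono2 del: sum.op_ivl_Suc)

lemma mu_u_mono:
  assumes "smoothness_vector m p r" "i \<le> j" "j \<le> m"
  shows "mu_u p r i \<le> mu_u p r j"
  using assms by (simp add: int_mu_u(2)[OF assms(1)] sum_mono2 del: sum.op_ivl_Suc)

lemma spline_dim_eq_mu_v:
  assumes "smoothness_vector m p r" "1 \<le> m"
  shows "spline_dim m p r = mu_v p r m"
proof -
  obtain k where m: "m = Suc k" using assms(2) by (cases m) auto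
  have "(\<Sum>i=1..m. int (p i) + 1) - (\<Sum>i=1..m-1. r i + 1) = (\<Sum>j=1..m. int (p j) - r j)"
    using assms(1) unfolding smoothness_vector_def m
    by (simp add: sum.distrib sum_subtractf)
  then show ?thesis by (simp add: spline_dim_def mu_v_def)
qed

lemma spline_dim_eq_mu_u:
  assumes "smoothness_vector m p r" "1 \<le> m"
  shows "spline_dim m p r = mu_u p r m"
proof -
  obtain k where m: "m = Suc k" using assms(2) by (cases m) auto
  have 1: "(\<Sum>i=1..m. int (p i) + 1) = (\<Sum>j<m. int (p (j + 1)) + 1)"
    by (rule sum.reindex_bij_witness[of _ "\<lambda>j. j + 1" "\<lambda>j. j - 1"]) auto
  have 2: "(\<Sum>j<m. r j + 1) = (\<Sum>i=1..m-1. r i + 1)"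
  proof -
    have "{..<m} = insert 0 {1..m-1}" using assms(2) by auto
    then show ?thesis using assms(1) by (simp add: smoothness_vector_def)
  qed
  have "(\<Sum>i=1..m. int (p i) + 1) - (\<Sum>i=1..m-1. r i + 1) = (\<Sum>j<m. int (p (j + 1)) - r j)"
    unfolding 1 2[symmetric] by (simp add: sum_subtractf[symmetric])
  then show ?thesis by (simp add: spline_dim_def mu_u_def)
qed

lemma v_index_iff:
  assumes sm: "smoothness_vector m p r" and "1 \<le> m" "1 \<le> k" "k \<le> spline_dim m p r"
  shows "v_indices m p r ! (k - 1) = j \<longleftrightarrow>
    1 \<le> j \<and> j \<le> m \<and> mu_v p r (j - 1) < k \<and> k \<le> mu_v p r j"
proof -
  let ?c = "\<lambda>j. nat (int (p j) - r j)"
  have V: "v_indices m p r = index_runs ?c 1 (Suc m)"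
    by (simp add: v_indices_def index_runs_def)
  have "k - 1 < sum ?c {1..<Suc m}"
    using assms(3,4) int_mu_v(2)[OF sm, of m] unfolding spline_dim_eq_mu_v[OF sm \<open>1 \<le> m\<close>] by linarith
  then have nth: "index_runs ?c 1 (Suc m) ! (k - 1) = j \<longleftrightarrow>
      1 \<le> j \<and> j < Suc m \<and> sum ?c {1..<j} \<le> k - 1 \<and> k - 1 < sum ?c {1..<Suc j}"
    by (intro nth_index_runs_iff) simp
  show ?thesis
  proof (cases "1 \<le> j \<and> j \<le> m")
    case True
    then have "sum ?c {1..<j} = mu_v p r (j - 1)" "sum ?c {1..<Suc j} = mu_v p r j"
      using int_mu_v(2)[OF sm, of j] int_mu_v(2)[OF sm, of "j - 1"]
      by (simp_all del: sum.op_ivl_Suc add: diff_le_self[THEN le_trans])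
    then show ?thesis using True \<open>1 \<le> k\<close> unfolding V nth by linarith
  next
    case False
    then show ?thesis unfolding V nth by linarith
  qed
qed

lemma u_index_iff:
  assumes sm: "smoothness_vector m p r" and "1 \<le> m" "1 \<le> k" "k \<le> spline_dim m p r"
  shows "u_indices m p r ! (k - 1) = j \<longleftrightarrow>
    j < m \<and> mu_u p r j < k \<and> k \<le> mu_u p r (Suc j)"
proof -
  let ?c = "\<lambda>j. nat (int (p (j + 1)) - r j)"
  have U: "u_indices m p r = index_runs ?c 0 m"
    by (simp add: u_indices_def index_runs_def)
  have "k - 1 < sum ?c {0..<m}"
    using assms(3,4) int_mu_u(2)[OF sm, of m] unfolding spline_dim_eq_mu_u[OF sm \<open>1 \<le> m\<close>] by linarith
  then have nth: "index_runs ?c 0 m ! (k - 1) = j \<longleftrightarrow>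
      0 \<le> j \<and> j < m \<and> sum ?c {0..<j} \<le> k - 1 \<and> k - 1 < sum ?c {0..<Suc j}"
    by (intro nth_index_runs_iff) simp
  show ?thesis
  proof (cases "j < m")
    case True
    then have "sum ?c {0..<j} = mu_u p r j" "sum ?c {0..<Suc j} = mu_u p r (Suc j)"
      using int_mu_u(2)[OF sm, of j] int_mu_u(2)[OF sm, of "Suc j"] by simp_all
    then show ?thesis using True \<open>1 \<le> k\<close> unfolding U nth by linarith
  next
    case False
    then show ?thesis unfolding U nth by linarith
  qed
qed

section \<open>Breakpoints and smoothness at the knots\<close>

lemma partition_less:
  assumes "is_partition m x" "i < j" "j \<le> m"
  shows "x i < x j"
  using assms(2,3)
proof (induction j)
  case (Suc j)
  have "x j < x (Suc j)" using assms(1) Suc.prems by (simp add: is_partition_def)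
  then show ?case using Suc by (cases "i = j") auto
qed simp

lemma partition_eq_iff:
  assumes "is_partition m x" "i \<le> m" "j \<le> m"
  shows "x i = x j \<longleftrightarrow> i = j"
  using partition_less[OF assms(1)] assms(2,3) by (metis less_irrefl linorder_neqE_nat)

lemma Max_atMost_nat: "Max {..k} = k" for k :: nat
  by (rule Max_eqI) auto

lemma partition_range:
  assumes "is_partition m x" "j \<le> m"
  shows "x 0 \<le> x j" "x j \<le> x m"
  using partition_less[OF assms(1), of 0 j] partition_less[OF assms(1), of j m] assms(2)
  by (cases "j = 0"; cases "j = m"; force)+

text \<open>The copies of \<^term>\<open>x j\<close> in \<open>v\<close> are numbered from \<^term>\<open>mu_v p r (j - 1) + 1\<close> to \<^term>\<open>mu_v p r j\<close>, so
the maximum in the definition of \<^const>\<open>r_v\<close> counts those before the \<open>k\<close>-th knot.  In this form it is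
visible that passing to the next copy of a knot lowers the smoothness by one.\<close>

lemma r_v_eq:
  assumes part: "is_partition m x" and sm: "smoothness_vector m p r"
    and k: "1 \<le> k" "k \<le> spline_dim m p r" and j: "v_indices m p r ! (k - 1) = j"
  shows "r_v m x p r k = int (p j) - int k + int (mu_v p r (j - 1))"
proof -
  have m: "1 \<le> m" using part by (simp add: is_partition_def)
  note idx = v_index_iff[OF sm m]
  have jk: "1 \<le> j" "j \<le> m" "mu_v p r (j - 1) < k" "k \<le> mu_v p r j"
    using idx[OF k] j by blast+
  have eq: "v_knot m x p r k = v_knot m x p r (k - l) \<longleftrightarrow> l < k - mu_v p r (j - 1)" if "l < k" for l
  proof -
    define j' where "j' = v_indices m p r ! (k - l - 1)"
    have kl: "1 \<le> k - l" "k - l \<le> spline_dim m p r" using that k by simp_all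
    have "j' \<le> m" using idx[OF kl, of j'] j'_def by simp
    then have "v_knot m x p r k = v_knot m x p r (k - l) \<longleftrightarrow> v_indices m p r ! (k - l - 1) = j"
      using partition_eq_iff[OF part \<open>j \<le> m\<close>, of j'] j j'_def unfolding v_knot_def by auto
    also have "\<dots> \<longleftrightarrow> mu_v p r (j - 1) < k - l"
      using idx[OF kl, of j] jk by auto
    finally show ?thesis by auto
  qed
  have "{l. l < k \<and> v_knot m x p r k = v_knot m x p r (k - l)} =
      {l. l < k \<and> l < k - mu_v p r (j - 1)}"
    using eq by blast
  also have "\<dots> = {..k - 1 - mu_v p r (j - 1)}" using jk by auto
  finally have "Max {l. l < k \<and> v_knot m x p r k = v_knot m x p r (k - l)} = k - 1 - mu_v p r (j - 1)"
    by (simp add: Max_atMost_nat)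
  then show ?thesis using jk unfolding r_v_def j by simp
qed

lemma r_u_eq:
  assumes part: "is_partition m x" and sm: "smoothness_vector m p r"
    and k: "1 \<le> k" "k \<le> spline_dim m p r" and j: "u_indices m p r ! (k - 1) = j"
  shows "r_u m x p r k = int (p (j + 1)) - 1 - (int (mu_u p r (Suc j)) - int k)"
proof -
  have m: "1 \<le> m" using part by (simp add: is_partition_def)
  note idx = u_index_iff[OF sm m]
  have jk: "j < m" "mu_u p r j < k" "k \<le> mu_u p r (Suc j)"
    using idx[OF k] j by blast+
  have dim: "mu_u p r (Suc j) \<le> spline_dim m p r"
    using mu_u_mono[OF sm, of "Suc j" m] jk(1) spline_dim_eq_mu_u[OF sm m] by simp
  have eq: "u_knot m x p r k = u_knot m x p r (k + l) \<longleftrightarrow> k + l \<le> mu_u p r (Suc j)"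
    if "k + l \<le> spline_dim m p r" for l
  proof -
    define j' where "j' = u_indices m p r ! (k + l - 1)"
    have kl: "1 \<le> k + l" "k + l \<le> spline_dim m p r" using that k by simp_all
    have "j' < m" using idx[OF kl, of j'] j'_def by simp
    then have "u_knot m x p r k = u_knot m x p r (k + l) \<longleftrightarrow> u_indices m p r ! (k + l - 1) = j"
      using partition_eq_iff[OF part, of j j'] jk(1) j j'_def unfolding u_knot_def by auto
    also have "\<dots> \<longleftrightarrow> k + l \<le> mu_u p r (Suc j)"
      using idx[OF kl, of j] jk by auto
    finally show ?thesis .
  qed
  have "{l. k + l \<le> spline_dim m p r \<and> u_knot m x p r k = u_knot m x p r (k + l)} =
      {l. k + l \<le> spline_dim m p r \<and> k + l \<le> mu_u p r (Suc j)}"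
    using eq by blast
  also have "\<dots> = {..mu_u p r (Suc j) - k}" using jk dim by auto
  finally have "Max {l. k + l \<le> spline_dim m p r \<and> u_knot m x p r k = u_knot m x p r (k + l)}
      = mu_u p r (Suc j) - k"
    by (simp add: Max_atMost_nat)
  then show ?thesis using jk unfolding r_u_def j by simp
qed

lemma mu_v_step:
  assumes "smoothness_vector m p r" "1 \<le> j" "j \<le> m"
  shows "int (mu_v p r j) = int (mu_v p r (j - 1)) + int (p j) - r j"
  using assms by (cases j) (simp_all add: int_mu_v(1)[OF assms(1)])

lemma mu_u_step:
  assumes "smoothness_vector m p r" "j < m"
  shows "int (mu_u p r (Suc j)) = int (mu_u p r j) + int (p (j + 1)) - r j"
  using assms by (simp add: int_mu_u(1)[OF assms(1)])

lemma smoothness_ge: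
  assumes "smoothness_vector m p r" "j \<le> m"
  shows "-1 \<le> r j"
proof (cases "j = 0 \<or> j = m")
  case False
  then have "j \<in> {1..m-1}" using assms(2) by auto
  then show ?thesis using assms(1) unfolding smoothness_vector_def by blast
qed (use assms in \<open>auto simp: smoothness_vector_def\<close>)

section \<open>Splines and GTB-spline bases\<close>

lemma spline_piece_Ck:
  assumes "s \<in> spline_space m x p r T" "j \<in> {1..m}" "ECT_space (p j) (x (j - 1)) (x j) (T j)"
  obtains f where "Ck_on (p j) f {x (j - 1)..x j}"
    and "\<And>y. y \<in> {x (j - 1)<..<x j} \<Longrightarrow> s y = f y"
proof -
  from assms(1,2) have "restr (J m x j) s \<in> restr (J m x j) ` T j"
    by (simp add: spline_space_def)
  then obtain t where t: "t \<in> T j" "restr (J m x j) s = restr (J m x j) t" by blast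
  have "s y = t y" if "y \<in> {x (j - 1)<..<x j}" for y
  proof -
    have "y \<in> J m x j" using that by (auto simp: J_def)
    with fun_cong[OF t(2), of y] show ?thesis by (simp add: restr_def)
  qed
  then show thesis using that ECT_space_Ck[OF assms(3) t(1)] by blast
qed

lemma sum_scaleR_fun_apply:
  fixes f :: "'k \<Rightarrow> real \<Rightarrow> real"
  shows "(\<Sum>k\<in>A. c k *\<^sub>R f k) y = (\<Sum>k\<in>A. c k * f k y)"
  by (induction A rule: infinite_finite_induct)
    (simp_all add: zero_fun_def plus_fun_def scaleR_fun_def)

lemma GTB_basisD:
  assumes "GTB_basis m x p r T N" "k \<in> {1..spline_dim m p r}"
  shows "u_knot m x p r k < y \<Longrightarrow> y < v_knot m x p r k \<Longrightarrow> 0 < N k y"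
    and "y < u_knot m x p r k \<Longrightarrow> N k y = 0"
    and "v_knot m x p r k < y \<Longrightarrow> N k y = 0"
    and "exactly_C (r_u m x p r k) (N k) (u_knot m x p r k)"
    and "exactly_C (r_v m x p r k) (N k) (v_knot m x p r k)"
  using assms unfolding GTB_basis_def by auto

lemma GTB_in_spline_space:
  assumes "GTB_basis m x p r T N" "k \<in> {1..spline_dim m p r}"
  shows "N k \<in> spline_space m x p r T"
  using assms unfolding GTB_basis_def by (metis imageI span_base)

lemma GTB_expansion:
  assumes "GTB_basis m x p r T N" "s \<in> spline_space m x p r T"
  shows "\<exists>c. \<forall>y. s y = (\<Sum>k=1..spline_dim m p r. c k * N k y)"
proof -
  let ?A = "{1..spline_dim m p r}"
  have "s \<in> span (N ` ?A)" "inj_on N ?A"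
    using assms by (simp_all add: GTB_basis_def)
  then obtain w where "s = (\<Sum>f\<in>N ` ?A. w f *\<^sub>R f)"
    by (auto simp: span_finite)
  then have "s = (\<Sum>k\<in>?A. w (N k) *\<^sub>R N k)"
    using \<open>inj_on N ?A\<close> by (simp add: sum.reindex)
  then have "\<forall>y. s y = (\<Sum>k\<in>?A. w (N k) * N k y)"
    by (simp add: sum_scaleR_fun_apply)
  then show ?thesis by (rule exI[of _ "\<lambda>k. w (N k)"])
qed

text \<open>Independence is a statement about functions on the whole line; a relation on the partitioned interval
extends to it because splines vanish outside.\<close>

lemma GTB_coefficients_zero:
  assumes G: "GTB_basis m x p r T N"
    and zero: "\<And>y. y \<in> {x 0..x m} \<Longrightarrow> (\<Sum>k=1..spline_dim m p r. c k * N k y) = 0"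
    and "k \<in> {1..spline_dim m p r}"
  shows "c k = 0"
proof -
  let ?A = "{1..spline_dim m p r}"
  have inj: "inj_on N ?A" and ind: "independent (N ` ?A)"
    using G by (simp_all add: GTB_basis_def)
  have "(\<Sum>l\<in>?A. c l * N l y) = 0" for y
  proof (cases "y \<in> {x 0..x m}")
    case False
    then have "N l y = 0" if "l \<in> ?A" for l
      using GTB_in_spline_space[OF G that] by (simp add: spline_space_def)
    then show ?thesis by simp
  qed (use zero in simp)
  then have "(\<Sum>l\<in>?A. c l *\<^sub>R N l) = 0"
    by (simp add: fun_eq_iff sum_scaleR_fun_apply)
  then have "(\<Sum>f\<in>N ` ?A. c (inv_into ?A N f) *\<^sub>R f) = 0"
    using inj by (simp add: sum.reindex)
  from independentD[OF ind _ subset_refl this, of "N k"]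
  have "c (inv_into ?A N (N k)) = 0" using assms(3) by simp
  then show ?thesis using inj assms(3) by simp
qed

text \<open>Were the interval empty, \<^term>\<open>N k\<close> would vanish off a single point; then all its one-sided derivatives,
and hence all its jumps, would be zero, while \<^const>\<open>exactly_C\<close> demands a nonzero one.\<close>

lemma GTB_support_nonempty:
  assumes G: "GTB_basis m x p r T N" and k: "k \<in> {1..spline_dim m p r}"
  shows "u_knot m x p r k < v_knot m x p r k"
proof (rule ccontr)
  let ?u = "u_knot m x p r k" and ?v = "v_knot m x p r k"
  assume "\<not> ?u < ?v"
  then have "{?u..?v} \<subseteq> {?v}" by auto
  moreover have "N k y = 0" if "y \<notin> {?u..?v}" for y
    using GTB_basisD(2,3)[OF G k, of y] that by auto
  ultimately have zero: "N k y = 0" if "y \<noteq> ?v" for y using that by blast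
  have "jump j (N k) ?v = 0" for j
    using one_sided_deriv_vanishing[of "?v - 1" ?v "N k" j]
      one_sided_deriv_vanishing[of ?v "?v + 1" "N k" j] zero
    by (simp add: jump_def)
  moreover have "exactly_C (r_v m x p r k) (N k) ?v"
    using G k by (rule GTB_basisD(5))
  ultimately show False by (simp add: exactly_C_def)
qed

text \<open>Rearranging by the basis functions \<open>g\<close> of the finer space: \<^term>\<open>g k\<close> receives a contribution from its
own index and from the preceding one, and the conditionals remove the neighbour missing at either end.\<close>

lemma sum_two_term:
  fixes \<alpha> \<beta> c g :: "nat \<Rightarrow> real"
  shows "(\<Sum>k=1..l. c k * (\<alpha> k * g k + \<beta> (k + 1) * g (k + 1))) =
    (\<Sum>k=1..Suc l. ((if k \<le> l then \<alpha> k else 0) * c k + (if 2 \<le> k then \<beta> k else 0) * c (k - 1)) * g k)"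
proof -
  have 1: "(\<Sum>k=1..Suc l. (if k \<le> l then \<alpha> k else 0) * c k * g k) = (\<Sum>k=1..l. c k * (\<alpha> k * g k))"
    by (simp add: ac_simps)
  have "(\<Sum>k=1..Suc l. (if 2 \<le> k then \<beta> k else 0) * c (k - 1) * g k) =
      (\<Sum>k=Suc 1..Suc l. (if 2 \<le> k then \<beta> k else 0) * c (k - 1) * g k)"
    by (simp add: sum.atLeast_Suc_atMost)
  also have "\<dots> = (\<Sum>k=1..l. c k * (\<beta> (k + 1) * g (k + 1)))"
    unfolding sum.shift_bounds_cl_Suc_ivl by (simp add: ac_simps)
  finally show ?thesis using 1 by (simp add: distrib_right distrib_left sum.distrib)
qed

section \<open>Knot insertion\<close>

text \<open>Here \<open>N\<close>, \<open>n\<close> and \<open>r\<close> belong to the larger space and \<open>Nt\<close>, \<open>rt\<close> to its subspace of splines that are one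
order smoother at \<^term>\<open>x i\<close>.\<close>

locale knot_insertion =
  fixes m i :: nat and x :: "nat \<Rightarrow> real" and p :: "nat \<Rightarrow> nat" and r rt :: "nat \<Rightarrow> int"
    and T :: "nat \<Rightarrow> (real \<Rightarrow> real) set"
    and N Nt :: "nat \<Rightarrow> real \<Rightarrow> real" and \<alpha> \<beta> :: "nat \<Rightarrow> real" and n :: nat
  assumes part: "is_partition m x"
    and smooth: "smoothness_vector m p r"
    and ECT: "\<And>j. j \<in> {1..m} \<Longrightarrow> ECT_space (p j) (x (j - 1)) (x j) (T j)"
    and i: "i \<in> {1..m-1}" and ri: "r i < min (int (p i)) (int (p (i + 1)))"
    and rt: "rt = r(i := r i + 1)"
    and n: "n = spline_dim m p r"
    and N: "GTB_basis m x p r T N"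
    and Nt: "GTB_basis m x p rt T Nt"
    and two_term: "\<And>k y. k \<in> {1..n-1} \<Longrightarrow> y \<in> {x 0..x m} \<Longrightarrow>
           Nt k y = \<alpha> k * N k y + \<beta> (k + 1) * N (k + 1) y"
begin

lemma m_pos: "1 \<le> m" and i_bounds: "1 \<le> i" "i < m"
  using part i by (auto simp: is_partition_def)

lemma smooth_rt: "smoothness_vector m p rt"
proof -
  have "-1 \<le> r i" using smoothness_ge[OF smooth, of i] i_bounds by simp
  then have "-1 \<le> r i + 1" by simp
  then show ?thesis using smooth i ri unfolding smoothness_vector_def rt by auto
qed

lemma n_eq_mu: "n = mu_v p r m" "n = mu_u p r m"
  using n spline_dim_eq_mu_v[OF smooth m_pos] spline_dim_eq_mu_u[OF smooth m_pos] by simp_all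

lemma mu_v_rt:
  assumes "j \<le> m"
  shows "int (mu_v p rt j) = int (mu_v p r j) - (if i \<le> j then 1 else 0)"
proof -
  have "(\<Sum>l=1..j. int (p l) - rt l) = (\<Sum>l=1..j. (int (p l) - r l) - (if l = i then 1 else 0))"
    by (rule sum.cong) (simp_all add: rt)
  then show ?thesis
    using i_bounds by (simp add: int_mu_v(1)[OF smooth assms] int_mu_v(1)[OF smooth_rt assms] sum_subtractf)
qed

lemma mu_u_rt:
  assumes "j \<le> m"
  shows "int (mu_u p rt j) = int (mu_u p r j) - (if i < j then 1 else 0)"
proof -
  have "(\<Sum>l<j. int (p (l + 1)) - rt l) = (\<Sum>l<j. (int (p (l + 1)) - r l) - (if l = i then 1 else 0))"
    by (rule sum.cong) (simp_all add: rt)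
  then show ?thesis
    by (simp add: int_mu_u(1)[OF smooth assms] int_mu_u(1)[OF smooth_rt assms] sum_subtractf)
qed

lemma dim_rt: "spline_dim m p rt = n - 1"
  using mu_v_rt[of m] i_bounds n_eq_mu spline_dim_eq_mu_v[OF smooth_rt m_pos] by simp

lemma mu_bounds: "1 \<le> mu_v p r i" "mu_v p r i < n" "1 \<le> mu_u p r i" "mu_u p r i < n"
proof -
  show "1 \<le> mu_v p r i" using mu_v_step[OF smooth, of i] i_bounds ri by simp
  have "int (mu_u p r i) < int (mu_u p r (Suc i))"
    using mu_u_step[OF smooth, of i] i_bounds ri by simp
  then show "mu_u p r i < n"
    using mu_u_mono[OF smooth, of "Suc i" m] i_bounds n_eq_mu by simp
  have r_ends: "r 0 = -1" "r m = -1" using smooth by (simp_all add: smoothness_vector_def)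
  have "mu_v p r i \<le> mu_v p r (m - 1)"
    using mu_v_mono[OF smooth, of i "m - 1"] i_bounds by simp
  then show "mu_v p r i < n"
    using mu_v_step[OF smooth, of m] m_pos r_ends n_eq_mu by simp
  have "mu_u p r 1 \<le> mu_u p r i"
    using mu_u_mono[OF smooth, of 1 i] i_bounds by simp
  then show "1 \<le> mu_u p r i"
    using mu_u_step[OF smooth, of 0] m_pos r_ends by simp
qed

text \<open>In \<open>Nt (k - 1) = \<alpha> (k - 1) N (k - 1) + \<beta> k N k\<close> the functions \<open>Nt (k - 1)\<close> and \<open>N (k - 1)\<close> have the same
right end and the same smoothness there, since the knots of \<open>v\<close> numbered below \<^term>\<open>mu_v p r i\<close> are
unaffected by the insertion.  The function \<open>N k\<close> either extends further to the right or ends at the same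
knot with one order of smoothness less, so it cannot take part.\<close>

lemma beta_zero:
  assumes k: "1 < k" "k \<le> mu_v p r i"
  shows "\<beta> k = 0"
proof -
  have kn: "k < n" using k mu_bounds by simp
  define j where "j = v_indices m p r ! (k - 1)"
  define j' where "j' = v_indices m p r ! (k - 1 - 1)"
  have j: "1 \<le> j" "j \<le> m" "mu_v p r (j - 1) < k" "k \<le> mu_v p r j"
    using v_index_iff[OF smooth m_pos, of k j] k kn n by (auto simp: j_def)
  have j': "1 \<le> j'" "j' \<le> m" "mu_v p r (j' - 1) < k - 1" "k - 1 \<le> mu_v p r j'"
    using v_index_iff[OF smooth m_pos, of "k - 1" j'] k kn n by (auto simp: j'_def)
  have "j' \<le> j"
    using mu_v_mono[OF smooth, of j "j' - 1"] j j' by fastforce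
  have "j' \<le> i"
    using mu_v_mono[OF smooth, of i "j' - 1"] j' k by fastforce
  have jt: "v_indices m p rt ! (k - 1 - 1) = j'"
  proof (subst v_index_iff[OF smooth_rt m_pos])
    have "int (mu_v p rt (j' - 1)) = int (mu_v p r (j' - 1))"
      using mu_v_rt[of "j' - 1"] j' \<open>j' \<le> i\<close> by simp
    moreover have "k - 1 \<le> mu_v p rt j'"
      using mu_v_rt[of j'] j' k \<open>j' \<le> i\<close> by (cases "j' = i") auto
    ultimately show "1 \<le> j' \<and> j' \<le> m \<and> mu_v p rt (j' - 1) < k - 1 \<and> k - 1 \<le> mu_v p rt j'"
      using j' by simp
  qed (use k kn dim_rt in simp_all)
  have knots: "v_knot m x p r k = x j" "v_knot m x p r (k - 1) = x j'"
    "v_knot m x p rt (k - 1) = x j'"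
    using jt by (simp_all add: v_knot_def j_def j'_def)
  have idx: "k \<in> {1..spline_dim m p r}" "k - 1 \<in> {1..spline_dim m p r}"
    "k - 1 \<in> {1..spline_dim m p rt}"
    using k kn n dim_rt by auto
  have zero: "N k y = 0" if "x j < y" for y
    using GTB_basisD(3)[OF N idx(1)] that knots by simp
  have zero': "N (k - 1) y = 0" if "x j' < y" for y
    using GTB_basisD(3)[OF N idx(2)] that knots by simp
  have zerot: "Nt (k - 1) y = 0" if "x j' < y" for y
    using GTB_basisD(3)[OF Nt idx(3)] that knots by simp
  have comb: "Nt (k - 1) y = \<alpha> (k - 1) * N (k - 1) y + \<beta> k * N k y" if "y \<in> {x 0..x m}" for y
    using two_term[of "k - 1" y] that idx(3) k dim_rt by simp
  show ?thesis
  proof (cases "j' = j")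
    case False
    \<comment> \<open>The right ends differ: evaluate where only \<open>N k\<close> survives.\<close>
    have "u_knot m x p r k < x j"
      using GTB_support_nonempty[OF N idx(1)] knots by simp
    moreover have "x j' < x j" using False \<open>j' \<le> j\<close> j partition_less[OF part, of j' j] by simp
    ultimately obtain y where y: "max (x j') (u_knot m x p r k) < y" "y < x j"
      using dense[of "max (x j') (u_knot m x p r k)" "x j"] by auto
    have "0 < N k y" using GTB_basisD(1)[OF N idx(1)] y knots by simp
    moreover have "y \<in> {x 0..x m}" using y partition_range[OF part, of j] partition_range[OF part, of j'] j j' by auto
    ultimately show ?thesis using comb[of y] zero'[of y] zerot[of y] y by simp
  next
    case True
    \<comment> \<open>The right ends agree: compare the first derivative in which \<open>N k\<close> jumps.\<close>
    have rv: "r_v m x p r k = int (p j) - int k + int (mu_v p r (j - 1))"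
      using r_v_eq[OF part smooth, of k j] idx j_def by simp
    have rv': "r_v m x p r (k - 1) = r_v m x p r k + 1"
      using r_v_eq[OF part smooth, of "k - 1" j'] idx j'_def rv True k by simp
    have rvt: "r_v m x p rt (k - 1) = r_v m x p r k + 1"
      using r_v_eq[OF part smooth_rt, of "k - 1" j'] idx jt rv True k mu_v_rt[of "j - 1"]
        \<open>j' \<le> i\<close> j by simp
    \<comment> \<open>There are at most \<open>p j - r j\<close> copies of the knot, so \<open>nat\<close> does not truncate the order \<open>q\<close> below.\<close>
    have "-1 \<le> r_v m x p r k"
      using mu_v_step[OF smooth j(1,2)] smoothness_ge[OF smooth j(2)] rv j by linarith
    define q where "q = nat (r_v m x p r k + 1)"
    have q: "int q = r_v m x p r k + 1" using \<open>-1 \<le> r_v m x p r k\<close> by (simp add: q_def)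
    have "q \<le> p j" using q rv j' True by simp
    have "jump q (N k) (x j) \<noteq> 0"
      using GTB_basisD(5)[OF N idx(1)] knots by (simp add: exactly_C_def q_def)
    moreover have "jump q (N (k - 1)) (x j) = 0"
      using GTB_basisD(5)[OF N idx(2)] knots True rv' q by (simp add: exactly_C_def)
    moreover have "jump q (Nt (k - 1)) (x j) = 0"
      using GTB_basisD(5)[OF Nt idx(3)] knots True rvt q by (simp add: exactly_C_def)
    ultimately have left: "left_deriv q (N k) (x j) \<noteq> 0" "left_deriv q (N (k - 1)) (x j) = 0"
      "left_deriv q (Nt (k - 1)) (x j) = 0"
      using jump_right_end[of "x j", OF zero] jump_right_end[of "x j", OF zero']
        jump_right_end[of "x j", OF zerot] True by simp_all
    have jm: "j \<in> {1..m}" using j by simp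
    obtain f where f: "Ck_on (p j) f {x (j - 1)..x j}"
      "\<And>y. y \<in> {x (j - 1)<..<x j} \<Longrightarrow> N k y = f y"
      using spline_piece_Ck[OF GTB_in_spline_space[OF N idx(1)] jm ECT[OF jm]] by blast
    obtain g where g: "Ck_on (p j) g {x (j - 1)..x j}"
      "\<And>y. y \<in> {x (j - 1)<..<x j} \<Longrightarrow> N (k - 1) y = g y"
      using spline_piece_Ck[OF GTB_in_spline_space[OF N idx(2)] jm ECT[OF jm]] by blast
    have "x (j - 1) < x j" using partition_less[OF part, of "j - 1" j] j by simp
    moreover have "Nt (k - 1) y = \<alpha> (k - 1) * N (k - 1) y + \<beta> k * N k y"
      if "y \<in> {x (j - 1)<..<x j}" for y
      using that partition_range[OF part, of j] partition_range(1)[OF part, of "j - 1"] j diff_le_self[of j 1]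
      by (intro comb) (force simp del: diff_le_self)
    ultimately have "left_deriv q (Nt (k - 1)) (x j) =
        \<alpha> (k - 1) * left_deriv q (N (k - 1)) (x j) + \<beta> k * left_deriv q (N k) (x j)"
      using \<open>q \<le> p j\<close> by (intro one_sided_deriv_linear(1)[OF _ g(1) f(1) _ g(2) f(2)]) auto
    then show ?thesis using left by simp
  qed
qed

text \<open>The mirror image of \<open>beta_zero\<close>: beyond \<^term>\<open>mu_u p r i\<close> the insertion shifts the knots of \<open>u\<close> by one
place, so \<open>Nt k\<close> starts where \<open>N (k + 1)\<close> does and equally smoothly, while \<open>N k\<close> starts earlier or at
the same knot with one order of smoothness less.\<close>

lemma alpha_zero:
  assumes k: "mu_u p r i < k" "k < n"
  shows "\<alpha> k = 0"
proof -
  have k1: "1 \<le> k" using k mu_bounds by simp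
  define j where "j = u_indices m p r ! (k - 1)"
  define j' where "j' = u_indices m p r ! (k + 1 - 1)"
  have j: "j < m" "mu_u p r j < k" "k \<le> mu_u p r (Suc j)"
    using u_index_iff[OF smooth m_pos, of k j] k k1 n by (auto simp: j_def)
  have j': "j' < m" "mu_u p r j' < k + 1" "k + 1 \<le> mu_u p r (Suc j')"
    using u_index_iff[OF smooth m_pos, of "k + 1" j'] k n by (auto simp: j'_def)
  have "j \<le> j'"
    using mu_u_mono[OF smooth, of "Suc j'" j] j j' by fastforce
  have "i \<le> j'"
    using mu_u_mono[OF smooth, of "Suc j'" i] i_bounds j' k by fastforce
  have jt: "u_indices m p rt ! (k - 1) = j'"
  proof (subst u_index_iff[OF smooth_rt m_pos])
    have "k \<le> mu_u p rt (Suc j')"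
      using mu_u_rt[of "Suc j'"] j' \<open>i \<le> j'\<close> by simp
    moreover have "mu_u p rt j' < k"
      using mu_u_rt[of j'] j' k \<open>i \<le> j'\<close> by (cases "j' = i") auto
    ultimately show "j' < m \<and> mu_u p rt j' < k \<and> k \<le> mu_u p rt (Suc j')"
      using j' by simp
  qed (use k k1 dim_rt in simp_all)
  have knots: "u_knot m x p r k = x j" "u_knot m x p r (k + 1) = x j'"
    "u_knot m x p rt k = x j'"
    using jt by (simp_all add: u_knot_def j_def j'_def)
  have idx: "k \<in> {1..spline_dim m p r}" "k + 1 \<in> {1..spline_dim m p r}"
    "k \<in> {1..spline_dim m p rt}"
    using k k1 n dim_rt by auto
  have zero: "N k y = 0" if "y < x j" for y
    using GTB_basisD(2)[OF N idx(1)] that knots by simp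
  have zero': "N (k + 1) y = 0" if "y < x j'" for y
    using GTB_basisD(2)[OF N idx(2)] that knots by simp
  have zerot: "Nt k y = 0" if "y < x j'" for y
    using GTB_basisD(2)[OF Nt idx(3)] that knots by simp
  have comb: "Nt k y = \<alpha> k * N k y + \<beta> (k + 1) * N (k + 1) y" if "y \<in> {x 0..x m}" for y
    using two_term[of k y] that k k1 by auto
  show ?thesis
  proof (cases "j = j'")
    case False
    \<comment> \<open>The left ends differ: evaluate where only \<open>N k\<close> survives.\<close>
    have "x j < v_knot m x p r k"
      using GTB_support_nonempty[OF N idx(1)] knots by simp
    moreover have "x j < x j'" using False \<open>j \<le> j'\<close> j' partition_less[OF part, of j j'] by simp
    ultimately obtain y where y: "x j < y" "y < min (x j') (v_knot m x p r k)"
      using dense[of "x j" "min (x j') (v_knot m x p r k)"] by auto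
    have "0 < N k y" using GTB_basisD(1)[OF N idx(1)] y knots by simp
    moreover have "y \<in> {x 0..x m}" using y partition_range[OF part, of j] partition_range[OF part, of j'] j j' by auto
    ultimately show ?thesis using comb[of y] zero'[of y] zerot[of y] y by simp
  next
    case True
    \<comment> \<open>The left ends agree: compare the first derivative in which \<open>N k\<close> jumps.\<close>
    have ru: "r_u m x p r k = int (p (j + 1)) - 1 - (int (mu_u p r (Suc j)) - int k)"
      using r_u_eq[OF part smooth, of k j] idx j_def by simp
    have ru': "r_u m x p r (k + 1) = r_u m x p r k + 1"
      using r_u_eq[OF part smooth, of "k + 1" j'] idx j'_def ru True by simp
    have rut: "r_u m x p rt k = r_u m x p r k + 1"
      using r_u_eq[OF part smooth_rt, of k j'] idx jt ru True mu_u_rt[of "Suc j"]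
        \<open>i \<le> j'\<close> j by simp
    \<comment> \<open>There are at most \<open>p (j + 1) - r j\<close> copies of the knot, so \<open>nat\<close> does not truncate the order \<open>q\<close> below.\<close>
    have "-1 \<le> r_u m x p r k"
      using mu_u_step[OF smooth j(1)] smoothness_ge[OF smooth, of j] ru j by simp
    define q where "q = nat (r_u m x p r k + 1)"
    have q: "int q = r_u m x p r k + 1" using \<open>-1 \<le> r_u m x p r k\<close> by (simp add: q_def)
    have "q \<le> p (j + 1)" using q ru j by simp
    have "jump q (N k) (x j) \<noteq> 0"
      using GTB_basisD(4)[OF N idx(1)] knots by (simp add: exactly_C_def q_def)
    moreover have "jump q (N (k + 1)) (x j) = 0"
      using GTB_basisD(4)[OF N idx(2)] knots True ru' q by (simp add: exactly_C_def)
    moreover have "jump q (Nt k) (x j) = 0"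
      using GTB_basisD(4)[OF Nt idx(3)] knots True rut q by (simp add: exactly_C_def)
    ultimately have right: "right_deriv q (N k) (x j) \<noteq> 0" "right_deriv q (N (k + 1)) (x j) = 0"
      "right_deriv q (Nt k) (x j) = 0"
      using jump_left_end[of "x j", OF zero] jump_left_end[of "x j", OF zero']
        jump_left_end[of "x j", OF zerot] True by simp_all
    have jm: "j + 1 \<in> {1..m}" using j by simp
    obtain f where f: "Ck_on (p (j + 1)) f {x j..x (j + 1)}"
      "\<And>y. y \<in> {x j<..<x (j + 1)} \<Longrightarrow> N k y = f y"
      using spline_piece_Ck[OF GTB_in_spline_space[OF N idx(1)] jm ECT[OF jm]] by auto
    obtain g where g: "Ck_on (p (j + 1)) g {x j..x (j + 1)}"
      "\<And>y. y \<in> {x j<..<x (j + 1)} \<Longrightarrow> N (k + 1) y = g y"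
      using spline_piece_Ck[OF GTB_in_spline_space[OF N idx(2)] jm ECT[OF jm]] by auto
    have "x j < x (j + 1)" using partition_less[OF part, of j "j + 1"] j by simp
    moreover have "Nt k y = \<alpha> k * N k y + \<beta> (k + 1) * N (k + 1) y"
      if "y \<in> {x j<..<x (j + 1)}" for y
      using that partition_range[OF part, of j] partition_range[OF part, of "j + 1"] j by (intro comb) auto
    ultimately have "right_deriv q (Nt k) (x j) =
        \<alpha> k * right_deriv q (N k) (x j) + \<beta> (k + 1) * right_deriv q (N (k + 1)) (x j)"
      using \<open>q \<le> p (j + 1)\<close> by (intro one_sided_deriv_linear(2)[OF _ f(1) g(1) _ f(2) g(2)]) auto
    then show ?thesis using right by simp
  qed
qed

text \<open>The weights \<open>\<alpha>\<close> and \<open>\<beta>\<close> continued by zero to the indices \<open>n\<close> and \<open>1\<close>, where one of the two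
neighbouring functions \<open>Nt k\<close> and \<open>Nt (k - 1)\<close> does not exist.\<close>

definition lower_weight :: "nat \<Rightarrow> real" where
  "lower_weight k = (if k \<le> n - 1 then \<alpha> k else 0)"

definition upper_weight :: "nat \<Rightarrow> real" where
  "upper_weight k = (if 2 \<le> k then \<beta> k else 0)"

lemma refined_expansion:
  assumes "y \<in> {x 0..x m}"
  shows "(\<Sum>k=1..n-1. c k * Nt k y) = (\<Sum>k=1..n. (lower_weight k * c k + upper_weight k * c (k - 1)) * N k y)"
proof -
  have "(\<Sum>k=1..n-1. c k * Nt k y) =
      (\<Sum>k=1..n-1. c k * (\<alpha> k * N k y + \<beta> (k + 1) * N (k + 1) y))"
    using two_term assms by (intro sum.cong) auto
  also have "\<dots> = (\<Sum>k=1..Suc (n-1). (lower_weight k * c k + upper_weight k * c (k - 1)) * N k y)"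
    unfolding lower_weight_def upper_weight_def by (rule sum_two_term)
  also have "Suc (n - 1) = n" using mu_bounds by simp
  finally show ?thesis .
qed

text \<open>The constant function \<open>1\<close> has all its coefficients equal to \<open>1\<close> in both bases.\<close>

lemma weights_sum:
  assumes "k \<in> {1..n}"
  shows "lower_weight k + upper_weight k = 1"
proof -
  have "(\<Sum>k=1..n. (lower_weight k + upper_weight k - 1) * N k y) = 0" if y: "y \<in> {x 0..x m}" for y
  proof -
    have "(\<Sum>k=1..n. N k y) = 1" "(\<Sum>k=1..n-1. Nt k y) = 1"
      using N Nt y n dim_rt unfolding GTB_basis_def by auto
    then show ?thesis
      using refined_expansion[OF y, of "\<lambda>_. 1"]
      by (simp add: algebra_simps sum.distrib sum_subtractf)
  qed
  then have "lower_weight k + upper_weight k - 1 = 0"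
    using GTB_coefficients_zero[OF N, of "\<lambda>k. lower_weight k + upper_weight k - 1" k] assms n by simp
  then show ?thesis by simp
qed

text \<open>Whenever one of the two weights is known to vanish, the other one is \<open>1\<close>, as they add up to \<open>1\<close>.\<close>

lemma refined_coefficient:
  assumes "k \<in> {1..n}"
  shows "lower_weight k * c k + upper_weight k * c (k - 1) =
    (if k \<le> mu_v p r i then c k
     else if k \<le> mu_u p r i then \<beta> k * c (k - 1) + \<alpha> k * c k
     else c (k - 1))"
proof -
  consider "k \<le> mu_v p r i" | "mu_v p r i < k" "k \<le> mu_u p r i" | "mu_v p r i < k" "mu_u p r i < k"
    by linarith
  then show ?thesis
  proof cases
    case 1
    then have "upper_weight k = 0" using beta_zero[of k] by (simp add: upper_weight_def)
    then show ?thesis using weights_sum[OF assms] 1 by simp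
  next
    case 2
    then have "lower_weight k = \<alpha> k" "upper_weight k = \<beta> k" using mu_bounds by (auto simp: lower_weight_def upper_weight_def)
    then show ?thesis using 2 by simp
  next
    case 3
    then have "lower_weight k = 0" using alpha_zero[of k] by (auto simp: lower_weight_def)
    then show ?thesis using weights_sum[OF assms] 3 by simp
  qed
qed

end

theorem theorem5p4:
  fixes m n i :: nat and a b :: real
    and x :: "nat \<Rightarrow> real" and p :: "nat \<Rightarrow> nat" and r rt :: "nat \<Rightarrow> int"
    and T :: "nat \<Rightarrow> (real \<Rightarrow> real) set"
    and N Nt :: "nat \<Rightarrow> real \<Rightarrow> real" and \<alpha> \<beta> :: "nat \<Rightarrow> real"
  assumes "is_partition m x" and "x 0 = a" and "x m = b"
    and "smoothness_vector m p r"
    and "\<And>j. j \<in> {1..m} \<Longrightarrow> ECT_space (p j) (x (j - 1)) (x j) (T j)"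
    and "i \<in> {1..m-1}" and "r i < min (int (p i)) (int (p (i + 1)))"
    and "rt = r(i := r i + 1)"
    and "n = spline_dim m p r"
    and "GTB_basis m x p r T N"
    and "GTB_basis m x p rt T Nt"
    and "\<And>k y. k \<in> {1..n-1} \<Longrightarrow> y \<in> {a..b} \<Longrightarrow>
           Nt k y = \<alpha> k * N k y + \<beta> (k + 1) * N (k + 1) y"
  shows "(\<forall>s \<in> spline_space m x p rt T.
            (\<exists>dt. \<forall>y\<in>{a..b}. s y = (\<Sum>k=1..n-1. dt k * Nt k y)) \<and>
            (\<forall>dt. (\<forall>y\<in>{a..b}. s y = (\<Sum>k=1..n-1. dt k * Nt k y)) \<longrightarrow>
               (let d = (\<lambda>k. if k \<le> mu_v p r i then dt k
                              else if k \<le> mu_u p r i then \<beta> k * dt (k - 1) + \<alpha> k * dt k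
                              else dt (k - 1))
                in \<forall>y\<in>{a..b}. s y = (\<Sum>k=1..n. d k * N k y)))) \<and>
         (\<forall>k. mu_v p r i < k \<and> k \<le> mu_u p r i \<longrightarrow> \<alpha> k + \<beta> k = 1)"
proof -
  interpret knot_insertion m i x p r rt T N Nt \<alpha> \<beta> n
    using assms by unfold_locales auto
  have expansion: "\<exists>dt. \<forall>y\<in>{a..b}. s y = (\<Sum>k=1..n-1. dt k * Nt k y)"
    if "s \<in> spline_space m x p rt T" for s
    using GTB_expansion[OF Nt that] unfolding dim_rt by blast
  have refinement: "s y = (\<Sum>k=1..n. (if k \<le> mu_v p r i then dt k
        else if k \<le> mu_u p r i then \<beta> k * dt (k - 1) + \<alpha> k * dt k else dt (k - 1)) * N k y)"
    if "\<forall>y\<in>{a..b}. s y = (\<Sum>k=1..n-1. dt k * Nt k y)" "y \<in> {a..b}" for s dt y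
  proof -
    have "s y = (\<Sum>k=1..n. (lower_weight k * dt k + upper_weight k * dt (k - 1)) * N k y)"
      using that refined_expansion[of y dt] assms(2,3) by simp
    also have "\<dots> = (\<Sum>k=1..n. (if k \<le> mu_v p r i then dt k
        else if k \<le> mu_u p r i then \<beta> k * dt (k - 1) + \<alpha> k * dt k else dt (k - 1)) * N k y)"
      by (intro sum.cong refl arg_cong2[of _ _ _ _ "(*)"] refined_coefficient)
    finally show ?thesis .
  qed
  have weights: "\<alpha> k + \<beta> k = 1" if "mu_v p r i < k" "k \<le> mu_u p r i" for k
    using weights_sum[of k] that mu_bounds by (auto simp: lower_weight_def upper_weight_def split: if_splits)
  show ?thesis
    unfolding Let_def using expansion refinement weights by blast
qed

end
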